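(* Let $\mathbf{k}$ be a field and let $\Omega$ and $X$ be nonempty sets. The pair $(\mathbf{k}^{\mathrm{NC}}_{\mathrm{NC},\Omega}\{X\},D_\Omega)$, with the natural injection $i:X\to\mathbf{k}^{\mathrm{NC}}_{\mathrm{NC},\Omega}\{X\}$, $x\mapsto(1,x)$, is the free noncommuting multi-differential noncommutative algebra on $X$ with noncommuting derivation set $D_\Omega=\{D_\omega\mid\omega\in\Omega\}$.
   Context: By an algebra is meant an associative $\mathbf{k}$-algebra. A *noncommuting multi-differential noncommutative algebra* indexed by $\Omega$ is a (not necessarily commutative) algebra $A$ equipped with a family $\delta_\Omega=\{\delta_\omega\mid\omega\in\Omega\}$ of derivations ($\mathbf{k}$-linear maps satisfying the Leibniz rule $d(xy)=d(x)y+x\,d(y)$) which are not necessarily pairwise commuting. A homomorphism $(R,\partial_\Omega)\to(S,\delta_\Omega)$ is an algebra homomorphism $f:R\to S$ with $f\circ\partial_\omega=\delta_\omega\circ f$ for all $\omega\in\Omega$. Being free on $X$ means: for every noncommuting multi-differential noncommutative algebra $(A,\delta_\Omega)$ indexed by $\Omega$ and every set map $f:X\to A$ there is a unique homomorphism $\bar f$ from the free object to $(A,\delta_\Omega)$ with $\bar f\circ i=f$. Let $M_{\mathrm{NC}}(\partial_\Omega)$ be the free (noncommutative) monoid of words $\partial_{\omega_1}\cdots\partial_{\omega_k}$, $k\ge0$, on the set of symbols $\partial_\Omega=\{\partial_\omega\mid\omega\in\Omega\}$, with unit $1$ the empty word, and $\Delta_{\mathrm{NC},\Omega}(X):=M_{\mathrm{NC}}(\partial_\Omega)\times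 X$; write $(\partial_{\omega_1}\cdots\partial_{\omega_k})(x)$ for $(\partial_{\omega_1}\cdots\partial_{\omega_k},x)$. Let $\mathbf{k}^{\mathrm{NC}}_{\mathrm{NC},\Omega}\{X\}:=\mathbf{k}\langle\Delta_{\mathrm{NC},\Omega}(X)\rangle$ be the noncommutative polynomial algebra on this set of variables, that is, the vector space spanned by the free monoid (words, including the empty word) on $\Delta_{\mathrm{NC},\Omega}(X)$ with concatenation product. For $\omega\in\Omega$, $D_\omega$ is the linear operator on $\mathbf{k}^{\mathrm{NC}}_{\mathrm{NC},\Omega}\{X\}$ extending, by the Leibniz rule, $D_\omega\big((\partial_{\omega_1}\cdots\partial_{\omega_k})(x)\big)=(\partial_\omega\partial_{\omega_1}\cdots\partial_{\omega_k})(x)$. *)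

theory Defs
  imports "HOL-Algebra.Module" "HOL-Library.FuncSet"
begin

text \<open>Unital associative algebras. The library locale \<open>algebra\<close> requires the
  multiplication to be commutative, so it cannot be used here.\<close>

locale nc_algebra = module K A + ring A for K (structure) and A (structure) +
  assumes smult_mult_left:
      "\<lbrakk>a \<in> carrier K; x \<in> carrier A; y \<in> carrier A\<rbrakk> \<Longrightarrow>
        (a \<odot>\<^bsub>A\<^esub> x) \<otimes>\<^bsub>A\<^esub> y = a \<odot>\<^bsub>A\<^esub> (x \<otimes>\<^bsub>A\<^esub> y)"
    and smult_mult_right:
      "\<lbrakk>a \<in> carrier K; x \<in> carrier A; y \<in> carrier A\<rbrakk> \<Longrightarrow>
        x \<otimes>\<^bsub>A\<^esub> (a \<odot>\<^bsub>A\<^esub> y) = a \<odot>\<^bsub>A\<^esub> (x \<otimes>\<^bsub>A\<^esub> y)"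

definition derivation ::
    "('k, 'e) ring_scheme \<Rightarrow> ('k, 'a, 'm) module_scheme \<Rightarrow> ('a \<Rightarrow> 'a) \<Rightarrow> bool" where
  "derivation K A d \<longleftrightarrow>
     d \<in> carrier A \<rightarrow> carrier A \<and>
     (\<forall>x\<in>carrier A. \<forall>y\<in>carrier A. d (x \<oplus>\<^bsub>A\<^esub> y) = d x \<oplus>\<^bsub>A\<^esub> d y) \<and>
     (\<forall>a\<in>carrier K. \<forall>x\<in>carrier A. d (a \<odot>\<^bsub>A\<^esub> x) = a \<odot>\<^bsub>A\<^esub> d x) \<and>
     (\<forall>x\<in>carrier A. \<forall>y\<in>carrier A. d (x \<otimes>\<^bsub>A\<^esub> y) = d x \<otimes>\<^bsub>A\<^esub> y \<oplus>\<^bsub>A\<^esub> x \<otimes>\<^bsub>A\<^esub> d y)"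

definition multi_diff_algebra ::
    "('k, 'e) ring_scheme \<Rightarrow> 'w set \<Rightarrow> ('k, 'a, 'm) module_scheme \<Rightarrow> ('w \<Rightarrow> 'a \<Rightarrow> 'a) \<Rightarrow> bool" where
  "multi_diff_algebra K \<Omega> A \<delta> \<longleftrightarrow>
     nc_algebra K A \<and> (\<forall>\<omega>\<in>\<Omega>. derivation K A (\<delta> \<omega>))"

text \<open>A homomorphism is only determined on the carrier of its domain, so it is taken to be
  \<open>extensional\<close> there; this makes equality of homomorphisms agree with equality as
  maps between the carriers.\<close>

definition multi_diff_hom ::
    "('k, 'e) ring_scheme \<Rightarrow> 'w set \<Rightarrow>
     ('k, 'a, 'm) module_scheme \<Rightarrow> ('w \<Rightarrow> 'a \<Rightarrow> 'a) \<Rightarrow>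
     ('k, 'b, 'n) module_scheme \<Rightarrow> ('w \<Rightarrow> 'b \<Rightarrow> 'b) \<Rightarrow> ('a \<Rightarrow> 'b) set" where
  "multi_diff_hom K \<Omega> R d S \<delta> =
     {f \<in> ring_hom R S \<inter> extensional (carrier R).
        (\<forall>a\<in>carrier K. \<forall>x\<in>carrier R. f (a \<odot>\<^bsub>R\<^esub> x) = a \<odot>\<^bsub>S\<^esub> f x) \<and>
        (\<forall>\<omega>\<in>\<Omega>. \<forall>x\<in>carrier R. f (d \<omega> x) = \<delta> \<omega> (f x))}"

text \<open>A differential variable is a pair \<open>(ds, x)\<close>, where the list \<open>[\<omega>\<^sub>1, \<dots>, \<omega>\<^sub>k]\<close> stands
  for the word of derivation symbols indexed by \<open>\<omega>\<^sub>1, \<dots>, \<omega>\<^sub>k\<close> in this order.\<close>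

type_synonym ('w, 'x) dvar = "'w list \<times> 'x"

definition diff_vars :: "'w set \<Rightarrow> 'x set \<Rightarrow> ('w, 'x) dvar set" where
  "diff_vars \<Omega> X = lists \<Omega> \<times> X"

text \<open>The noncommutative polynomial algebra on a set \<open>V\<close> of variables: an element is the
  finitely supported family of its coefficients with respect to the basis of words over \<open>V\<close>,
  and the product is the bilinear extension of concatenation.\<close>

definition nc_poly_algebra ::
    "('k, 'e) ring_scheme \<Rightarrow> 'v set \<Rightarrow> ('k, 'v list \<Rightarrow> 'k) module" where
  "nc_poly_algebra K V =
     \<lparr>carrier = {p. (\<forall>w. p w \<in> carrier K) \<and> finite {w. p w \<noteq> \<zero>\<^bsub>K\<^esub>} \<and>
                    {w. p w \<noteq> \<zero>\<^bsub>K\<^esub>} \<subseteq> lists V},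
      monoid.mult = (\<lambda>p q w. \<Oplus>\<^bsub>K\<^esub>s \<in> {(u, v). u @ v = w}. p (fst s) \<otimes>\<^bsub>K\<^esub> q (snd s)),
      one = (\<lambda>w. if w = [] then \<one>\<^bsub>K\<^esub> else \<zero>\<^bsub>K\<^esub>),
      zero = (\<lambda>w. \<zero>\<^bsub>K\<^esub>),
      add = (\<lambda>p q w. p w \<oplus>\<^bsub>K\<^esub> q w),
      smult = (\<lambda>a p w. a \<otimes>\<^bsub>K\<^esub> p w)\<rparr>"

definition nc_monom :: "('k, 'e) ring_scheme \<Rightarrow> 'v list \<Rightarrow> 'v list \<Rightarrow> 'k" where
  "nc_monom K w = (\<lambda>u. if u = w then \<one>\<^bsub>K\<^esub> else \<zero>\<^bsub>K\<^esub>)"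

definition free_mda ::
    "('k, 'e) ring_scheme \<Rightarrow> 'w set \<Rightarrow> 'x set \<Rightarrow> ('k, ('w, 'x) dvar list \<Rightarrow> 'k) module" where
  "free_mda K \<Omega> X = nc_poly_algebra K (diff_vars \<Omega> X)"

text \<open>The value of \<open>D\<^sub>\<omega>\<close> on a basis word, by the Leibniz rule from its values on variables.\<close>

primrec word_deriv ::
    "('k, 'e) ring_scheme \<Rightarrow> 'w set \<Rightarrow> 'x set \<Rightarrow> 'w \<Rightarrow> ('w, 'x) dvar list \<Rightarrow>
     (('w, 'x) dvar list \<Rightarrow> 'k)" where
  "word_deriv K \<Omega> X \<omega> [] = \<zero>\<^bsub>free_mda K \<Omega> X\<^esub>"
| "word_deriv K \<Omega> X \<omega> (v # w) =
     nc_monom K [(\<omega> # fst v, snd v)] \<otimes>\<^bsub>free_mda K \<Omega> X\<^esub> nc_monom K w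
     \<oplus>\<^bsub>free_mda K \<Omega> X\<^esub> nc_monom K [v] \<otimes>\<^bsub>free_mda K \<Omega> X\<^esub> word_deriv K \<Omega> X \<omega> w"

definition free_deriv ::
    "('k, 'e) ring_scheme \<Rightarrow> 'w set \<Rightarrow> 'x set \<Rightarrow> 'w \<Rightarrow>
     (('w, 'x) dvar list \<Rightarrow> 'k) \<Rightarrow> (('w, 'x) dvar list \<Rightarrow> 'k)" where
  "free_deriv K \<Omega> X \<omega> p =
     (\<Oplus>\<^bsub>free_mda K \<Omega> X\<^esub>w \<in> {w. p w \<noteq> \<zero>\<^bsub>K\<^esub>}. p w \<odot>\<^bsub>free_mda K \<Omega> X\<^esub> word_deriv K \<Omega> X \<omega> w)"

definition free_inj :: "('k, 'e) ring_scheme \<Rightarrow> 'x \<Rightarrow> (('w, 'x) dvar list \<Rightarrow> 'k)" where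
  "free_inj K x = nc_monom K [([], x)]"

end

theory Submission
  imports Defs
begin

text \<open>The words over \<open>V\<close> form a basis of the noncommutative polynomial algebra, so linear maps out
  of it are the linear extensions of arbitrary maps on words, and every (multi)linear identity need
  only be checked on words. Concatenation gives associativity, and the rule for \<open>D\<^sub>\<omega>\<close> on a
  concatenation gives Leibniz. A homomorphism \<open>g\<close> with \<open>g \<circ> i = f\<close> must send the variable
  \<open>([\<omega>\<^sub>1, \<dots>, \<omega>\<^sub>k], x)\<close> to \<open>\<delta> \<omega>\<^sub>1 (\<dots> (\<delta> \<omega>\<^sub>k (f x)))\<close>, hence is determined on words;
  conversely the linear extension of the resulting map on words is a homomorphism.\<close>

section \<open>Linear maps\<close>

text \<open>Extensionality is not demanded here, so that plain lambda terms built by composition,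
  addition and multiplication are members. Equality of such maps is only ever claimed on the
  carrier.\<close>

definition linear_maps ::
    "('k, 'e) ring_scheme \<Rightarrow> ('k, 'a, 'm) module_scheme \<Rightarrow> ('k, 'b, 'n) module_scheme \<Rightarrow>
     ('a \<Rightarrow> 'b) set" where
  "linear_maps K M N =
     {f \<in> carrier M \<rightarrow> carrier N.
        (\<forall>x\<in>carrier M. \<forall>y\<in>carrier M. f (x \<oplus>\<^bsub>M\<^esub> y) = f x \<oplus>\<^bsub>N\<^esub> f y) \<and>
        (\<forall>a\<in>carrier K. \<forall>x\<in>carrier M. f (a \<odot>\<^bsub>M\<^esub> x) = a \<odot>\<^bsub>N\<^esub> f x)}"

lemma linear_mapsI:
  assumes "\<And>x. x \<in> carrier M \<Longrightarrow> f x \<in> carrier N"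
    and "\<And>x y. \<lbrakk>x \<in> carrier M; y \<in> carrier M\<rbrakk> \<Longrightarrow> f (x \<oplus>\<^bsub>M\<^esub> y) = f x \<oplus>\<^bsub>N\<^esub> f y"
    and "\<And>a x. \<lbrakk>a \<in> carrier K; x \<in> carrier M\<rbrakk> \<Longrightarrow> f (a \<odot>\<^bsub>M\<^esub> x) = a \<odot>\<^bsub>N\<^esub> f x"
  shows "f \<in> linear_maps K M N"
  using assms by (auto simp: linear_maps_def)

lemma
  assumes "f \<in> linear_maps K M N"
  shows linear_maps_closed: "x \<in> carrier M \<Longrightarrow> f x \<in> carrier N"
    and linear_maps_add:
      "\<lbrakk>x \<in> carrier M; y \<in> carrier M\<rbrakk> \<Longrightarrow> f (x \<oplus>\<^bsub>M\<^esub> y) = f x \<oplus>\<^bsub>N\<^esub> f y"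
    and linear_maps_smult:
      "\<lbrakk>a \<in> carrier K; x \<in> carrier M\<rbrakk> \<Longrightarrow> f (a \<odot>\<^bsub>M\<^esub> x) = a \<odot>\<^bsub>N\<^esub> f x"
  using assms by (auto simp: linear_maps_def)

lemma linear_maps_id: "(\<lambda>x. x) \<in> linear_maps K M M"
  by (auto simp: linear_maps_def)

lemma linear_maps_comp:
  assumes "g \<in> linear_maps K N L" and "f \<in> linear_maps K M N"
  shows "(\<lambda>x. g (f x)) \<in> linear_maps K M L"
  using assms by (auto simp: linear_maps_def Pi_iff)

lemma linear_maps_plus:
  assumes N: "module K N" and f: "f \<in> linear_maps K M N" and g: "g \<in> linear_maps K M N"
  shows "(\<lambda>x. f x \<oplus>\<^bsub>N\<^esub> g x) \<in> linear_maps K M N"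
proof -
  interpret N: module K N by (rule N)
  note cl = linear_maps_closed[OF f] linear_maps_closed[OF g]
  show ?thesis
    by (rule linear_mapsI)
      (simp_all add: cl linear_maps_add[OF f] linear_maps_add[OF g] linear_maps_smult[OF f]
        linear_maps_smult[OF g] N.smult_r_distr N.a_ac)
qed

text \<open>Homogeneity at the zero scalar gives this. It supplies the base case when two linear
  maps are compared by induction.\<close>

lemma linear_maps_zero:
  assumes M: "module K M" and N: "module K N" and f: "f \<in> linear_maps K M N"
  shows "f \<zero>\<^bsub>M\<^esub> = \<zero>\<^bsub>N\<^esub>"
proof -
  interpret M: module K M by (rule M)
  interpret N: module K N by (rule N)
  have "f (\<zero>\<^bsub>K\<^esub> \<odot>\<^bsub>M\<^esub> \<zero>\<^bsub>M\<^esub>) = \<zero>\<^bsub>K\<^esub> \<odot>\<^bsub>N\<^esub> f \<zero>\<^bsub>M\<^esub>"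
    by (rule linear_maps_smult[OF f]) simp_all
  then show ?thesis
    by (simp add: linear_maps_closed[OF f])
qed

lemma (in nc_algebra) linear_maps_mult_left:
  assumes "x \<in> carrier A"
  shows "(\<lambda>y. x \<otimes>\<^bsub>A\<^esub> y) \<in> linear_maps K A A"
  using assms by (intro linear_mapsI) (simp_all add: r_distr smult_mult_right)

lemma (in nc_algebra) linear_maps_mult_right:
  assumes "y \<in> carrier A"
  shows "(\<lambda>x. x \<otimes>\<^bsub>A\<^esub> y) \<in> linear_maps K A A"
  using assms by (intro linear_mapsI) (simp_all add: l_distr smult_mult_left)

section \<open>Noncommutative polynomials\<close>

locale nc_poly = cring K for K :: "('k, 'e) ring_scheme" (structure) +
  fixes V :: "'v set"
begin

abbreviation P :: "('k, 'v list \<Rightarrow> 'k) module" where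
  "P \<equiv> nc_poly_algebra K V"

abbreviation supp :: "('v list \<Rightarrow> 'k) \<Rightarrow> 'v list set" where
  "supp p \<equiv> {w. p w \<noteq> \<zero>}"

section \<open>Module structure on noncommutative polynomials\<close>

lemma carrier_P:
  "p \<in> carrier P \<longleftrightarrow> (\<forall>w. p w \<in> carrier K) \<and> finite (supp p) \<and> supp p \<subseteq> lists V"
  by (simp add: nc_poly_algebra_def)

lemma zero_P: "\<zero>\<^bsub>P\<^esub> = (\<lambda>w. \<zero>)"
  and one_P: "\<one>\<^bsub>P\<^esub> = nc_monom K []"
  and add_P: "p \<oplus>\<^bsub>P\<^esub> q = (\<lambda>w. p w \<oplus> q w)"
  and smult_P: "a \<odot>\<^bsub>P\<^esub> p = (\<lambda>w. a \<otimes> p w)"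
  and mult_P: "p \<otimes>\<^bsub>P\<^esub> q = (\<lambda>w. \<Oplus>s \<in> {(u, v). u @ v = w}. p (fst s) \<otimes> q (snd s))"
  by (simp_all add: nc_poly_algebra_def nc_monom_def)

lemma coeff_closed [simp]: "p \<in> carrier P \<Longrightarrow> p w \<in> carrier K"
  by (simp add: carrier_P)

lemma carrierI:
  assumes "\<And>w. p w \<in> carrier K" "finite S" "supp p \<subseteq> S" "S \<subseteq> lists V"
  shows "p \<in> carrier P"
  using assms by (auto simp: carrier_P intro: finite_subset)

lemma monom_closed [simp]: "w \<in> lists V \<Longrightarrow> nc_monom K w \<in> carrier P"
  by (rule carrierI[of _ "{w}"]) (auto simp: nc_monom_def split: if_splits)

lemma zero_closed_P: "\<zero>\<^bsub>P\<^esub> \<in> carrier P"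
  by (rule carrierI[of _ "{}"]) (auto simp: zero_P)

lemma add_closed_P:
  assumes "p \<in> carrier P" "q \<in> carrier P"
  shows "p \<oplus>\<^bsub>P\<^esub> q \<in> carrier P"
  by (rule carrierI[of _ "supp p \<union> supp q"]) (use assms in \<open>auto simp: add_P carrier_P\<close>)

lemma smult_closed_P:
  assumes "a \<in> carrier K" "p \<in> carrier P"
  shows "a \<odot>\<^bsub>P\<^esub> p \<in> carrier P"
  by (rule carrierI[of _ "supp p"]) (use assms in \<open>auto simp: smult_P carrier_P\<close>)

lemma module_P: "module K P"
proof (rule module.intro)
  show "cring K" by (rule cring_axioms)
  show "abelian_group P"
  proof (rule abelian_groupI)
    fix p assume p: "p \<in> carrier P"
    \<comment> \<open>The additive inverse is taken to be the multiple by minus one, so that its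
      membership follows from closure under scalars.\<close>
    have "(\<ominus> \<one>) \<odot>\<^bsub>P\<^esub> p \<in> carrier P" using p by (intro smult_closed_P) auto
    moreover have "((\<ominus> \<one>) \<odot>\<^bsub>P\<^esub> p) \<oplus>\<^bsub>P\<^esub> p = \<zero>\<^bsub>P\<^esub>"
      using p by (auto simp: smult_P add_P zero_P l_minus l_neg)
    ultimately show "\<exists>q\<in>carrier P. q \<oplus>\<^bsub>P\<^esub> p = \<zero>\<^bsub>P\<^esub>" by blast
  qed (auto simp: zero_closed_P add_closed_P, auto simp: add_P zero_P a_ac)
  show "module_axioms K P"
  proof (rule module_axioms.intro)
  qed (auto simp: smult_closed_P, auto simp: smult_P add_P l_distr r_distr m_assoc)
qed

sublocale P: module K P by (rule module_P)

section \<open>Words as a basis: induction and linear extension\<close>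

lemma poly_decomp:
  assumes p: "p \<in> carrier P"
  shows "p = p(w := \<zero>) \<oplus>\<^bsub>P\<^esub> p w \<odot>\<^bsub>P\<^esub> nc_monom K w"
  using p by (auto simp: fun_eq_iff add_P smult_P nc_monom_def)

text \<open>The proof inducts on a finite set \<open>S\<close> that merely contains the support,
  peeling off one word of \<open>S\<close> at a time. Since \<open>S\<close> need not equal the
  support, a word whose coefficient happens to vanish needs no separate case.\<close>

lemma poly_induct [consumes 1, case_names zero add_monom]:
  assumes p: "p \<in> carrier P"
    and zero: "Q \<zero>\<^bsub>P\<^esub>"
    and step: "\<And>p a w. \<lbrakk>p \<in> carrier P; Q p; a \<in> carrier K; w \<in> lists V\<rbrakk> \<Longrightarrow>
      Q (p \<oplus>\<^bsub>P\<^esub> a \<odot>\<^bsub>P\<^esub> nc_monom K w)"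
  shows "Q p"
proof -
  have "Q p" if "finite S" "p \<in> carrier P" "supp p \<subseteq> S" "S \<subseteq> lists V" for S p
    using that
  proof (induction S arbitrary: p rule: finite_induct)
    case empty
    then have "p = \<zero>\<^bsub>P\<^esub>" by (auto simp: zero_P)
    then show ?case using zero by simp
  next
    case (insert w S)
    let ?q = "p(w := \<zero>)"
    have q: "?q \<in> carrier P"
      by (rule carrierI[of _ S]) (use insert in \<open>auto split: if_splits\<close>)
    have "supp ?q \<subseteq> S" using insert.prems by (auto split: if_splits)
    then have "Q ?q" using insert.prems q by (intro insert.IH) blast+
    then have "Q (?q \<oplus>\<^bsub>P\<^esub> p w \<odot>\<^bsub>P\<^esub> nc_monom K w)"
      using q insert.prems by (intro step coeff_closed) blast+
    then show ?case using poly_decomp[of p w] insert.prems by simp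
  qed
  from this[of "supp p" p] p show ?thesis by (auto simp: carrier_P)
qed

text \<open>This reduces identities to words. An identity in several factors is handled by applying
  it to one factor at a time with the others fixed.\<close>

lemma linear_maps_eqI:
  assumes N: "module K N" and f: "f \<in> linear_maps K P N" and g: "g \<in> linear_maps K P N"
    and eq: "\<And>w. w \<in> lists V \<Longrightarrow> f (nc_monom K w) = g (nc_monom K w)"
    and p: "p \<in> carrier P"
  shows "f p = g p"
  using p
proof (induction rule: poly_induct)
  case zero
  then show ?case using linear_maps_zero[OF module_P N] f g by metis
next
  case (add_monom p a w)
  then show ?case
    by (simp add: linear_maps_add[OF f] linear_maps_add[OF g] linear_maps_smult[OF f]
        linear_maps_smult[OF g] eq)
qed

text \<open>The sum is written in the same shape as \<open>free_deriv\<close>, which makes each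
  \<open>D \<omega>\<close> directly an instance.\<close>

definition lin_ext :: "('k, 'b, 'n) module_scheme \<Rightarrow> ('v list \<Rightarrow> 'b) \<Rightarrow> ('v list \<Rightarrow> 'k) \<Rightarrow> 'b" where
  "lin_ext N \<phi> p = (\<Oplus>\<^bsub>N\<^esub>w \<in> supp p. p w \<odot>\<^bsub>N\<^esub> \<phi> w)"

text \<open>Words outside the support contribute zero. Cancellation can shrink the support of a sum
  or of a scalar multiple, so additivity and homogeneity are verified over a common index set that
  contains all supports involved.\<close>

lemma lin_ext_superset:
  assumes N: "module K N" and \<phi>: "\<And>w. w \<in> lists V \<Longrightarrow> \<phi> w \<in> carrier N"
    and p: "p \<in> carrier P" and S: "finite S" "supp p \<subseteq> S" "S \<subseteq> lists V"
  shows "lin_ext N \<phi> p = (\<Oplus>\<^bsub>N\<^esub>w \<in> S. p w \<odot>\<^bsub>N\<^esub> \<phi> w)"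
proof -
  interpret N: module K N by (rule N)
  show ?thesis unfolding lin_ext_def
    by (rule N.add.finprod_mono_neutral_cong_left) (use p S \<phi> in \<open>auto simp: subset_iff\<close>)
qed

lemma lin_ext_linear:
  assumes N: "module K N" and \<phi>: "\<And>w. w \<in> lists V \<Longrightarrow> \<phi> w \<in> carrier N"
  shows "lin_ext N \<phi> \<in> linear_maps K P N"
proof (rule linear_mapsI)
  interpret N: module K N by (rule N)
  note sup = lin_ext_superset[OF N, of \<phi>, OF \<phi>]
  fix p assume p: "p \<in> carrier P"
  then have fp: "finite (supp p)" "supp p \<subseteq> lists V" by (auto simp: carrier_P)
  have cl: "p w \<odot>\<^bsub>N\<^esub> \<phi> w \<in> carrier N" if "p \<in> carrier P" "w \<in> lists V" for p w
    using that \<phi> by auto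
  show "lin_ext N \<phi> p \<in> carrier N"
    unfolding lin_ext_def using fp p cl by (intro N.finsum_closed) blast
  show "lin_ext N \<phi> (a \<odot>\<^bsub>P\<^esub> p) = a \<odot>\<^bsub>N\<^esub> lin_ext N \<phi> p" if a: "a \<in> carrier K" for a
  proof -
    have "lin_ext N \<phi> (a \<odot>\<^bsub>P\<^esub> p) = (\<Oplus>\<^bsub>N\<^esub>w \<in> supp p. (a \<odot>\<^bsub>P\<^esub> p) w \<odot>\<^bsub>N\<^esub> \<phi> w)"
      using p a fp by (intro sup P.smult_closed) (auto simp: smult_P[of a p])
    also have "\<dots> = (\<Oplus>\<^bsub>N\<^esub>w \<in> supp p. a \<odot>\<^bsub>N\<^esub> (p w \<odot>\<^bsub>N\<^esub> \<phi> w))"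
      using p a fp \<phi> by (intro N.finsum_cong') (auto simp: smult_P N.smult_assoc1 subset_iff)
    also have "\<dots> = a \<odot>\<^bsub>N\<^esub> lin_ext N \<phi> p"
      unfolding lin_ext_def using p a fp cl
      by (intro N.finsum_smult_ldistr[symmetric]) blast+
    finally show ?thesis .
  qed
  show "lin_ext N \<phi> (p \<oplus>\<^bsub>P\<^esub> q) = lin_ext N \<phi> p \<oplus>\<^bsub>N\<^esub> lin_ext N \<phi> q" if q: "q \<in> carrier P" for q
  proof -
    let ?S = "supp p \<union> supp q"
    from q have fq: "finite (supp q)" "supp q \<subseteq> lists V" by (auto simp: carrier_P)
    have "lin_ext N \<phi> (p \<oplus>\<^bsub>P\<^esub> q) = (\<Oplus>\<^bsub>N\<^esub>w \<in> ?S. (p \<oplus>\<^bsub>P\<^esub> q) w \<odot>\<^bsub>N\<^esub> \<phi> w)"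
      using p q fp fq by (intro sup P.add.m_closed) (auto simp: add_P[of p q])
    also have "\<dots> = (\<Oplus>\<^bsub>N\<^esub>w \<in> ?S. p w \<odot>\<^bsub>N\<^esub> \<phi> w \<oplus>\<^bsub>N\<^esub> q w \<odot>\<^bsub>N\<^esub> \<phi> w)"
      using p q fp fq \<phi>
      by (intro N.finsum_cong') (auto simp: add_P N.smult_l_distr subset_iff)
    also have "\<dots> = (\<Oplus>\<^bsub>N\<^esub>w \<in> ?S. p w \<odot>\<^bsub>N\<^esub> \<phi> w) \<oplus>\<^bsub>N\<^esub> (\<Oplus>\<^bsub>N\<^esub>w \<in> ?S. q w \<odot>\<^bsub>N\<^esub> \<phi> w)"
      using p q fp fq \<phi> by (intro N.finsum_addf) (auto simp: subset_iff)
    also have "(\<Oplus>\<^bsub>N\<^esub>w \<in> ?S. p w \<odot>\<^bsub>N\<^esub> \<phi> w) = lin_ext N \<phi> p"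
      using p fp fq by (intro sup[symmetric]) auto
    also have "(\<Oplus>\<^bsub>N\<^esub>w \<in> ?S. q w \<odot>\<^bsub>N\<^esub> \<phi> w) = lin_ext N \<phi> q"
      using q fp fq by (intro sup[symmetric]) auto
    finally show ?thesis .
  qed
qed

lemma lin_ext_monom:
  assumes N: "module K N" and \<phi>: "\<And>w. w \<in> lists V \<Longrightarrow> \<phi> w \<in> carrier N" and w: "w \<in> lists V"
  shows "lin_ext N \<phi> (nc_monom K w) = \<phi> w"
proof -
  interpret N: module K N by (rule N)
  \<comment> \<open>Enlarging the index set to \<open>{w}\<close> avoids deciding whether
    \<open>\<one>\<close> differs from \<open>\<zero>\<close>, that is, whether the support is all
    of \<open>{w}\<close>.\<close>
  have "lin_ext N \<phi> (nc_monom K w) = (\<Oplus>\<^bsub>N\<^esub>u \<in> {w}. nc_monom K w u \<odot>\<^bsub>N\<^esub> \<phi> u)"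
    using w monom_closed[OF w]
    by (intro lin_ext_superset[OF N, of \<phi>, OF \<phi>]) (auto simp: nc_monom_def split: if_splits)
  also have "\<dots> = \<phi> w"
    using w \<phi> by (simp add: nc_monom_def)
  finally show ?thesis .
qed

section \<open>The concatenation product and the algebra axioms\<close>

lemma finite_splits: "finite {(u, v). u @ v = (w :: 'v list)}"
proof (rule finite_subset)
  \<comment> \<open>A split is determined by the length of its first part.\<close>
  show "{(u, v). u @ v = w} \<subseteq> (\<lambda>n. (take n w, drop n w)) ` {..length w}"
  proof clarify
    fix u v :: "'v list" assume "w = u @ v"
    then show "(u, v) \<in> (\<lambda>n. (take n (u @ v), drop n (u @ v))) ` {..length (u @ v)}"
      by (intro image_eqI[of _ _ "length u"]) auto
  qed
qed simp

text \<open>At a word that is not a concatenation of words from the two supports, every summand of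
  the convolution has a zero factor. The support of the product therefore lies in a finite set of
  concatenations.\<close>

lemma mult_closed_P:
  assumes p: "p \<in> carrier P" and q: "q \<in> carrier P"
  shows "p \<otimes>\<^bsub>P\<^esub> q \<in> carrier P"
proof (rule carrierI)
  let ?S = "(\<lambda>(u, v). u @ v) ` (supp p \<times> supp q)"
  have "supp p \<subseteq> lists V" "supp q \<subseteq> lists V"
    using p q by (simp_all add: carrier_P)
  then show "?S \<subseteq> lists V" by (auto simp del: in_lists_conv_set) blast+
  show "finite ?S"
    using p q by (simp add: carrier_P)
  show "(p \<otimes>\<^bsub>P\<^esub> q) w \<in> carrier K" for w
    using p q by (auto simp: mult_P intro!: finsum_closed)
  show "supp (p \<otimes>\<^bsub>P\<^esub> q) \<subseteq> ?S"
  proof (rule subsetI, rule ccontr)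
    fix w assume w: "w \<in> supp (p \<otimes>\<^bsub>P\<^esub> q)" "w \<notin> ?S"
    have "p u \<otimes> q v = \<zero>" if "u @ v = w" for u v
    proof -
      have "p u = \<zero> \<or> q v = \<zero>" using that w(2) by auto
      then show ?thesis using p q by auto
    qed
    then have "(p \<otimes>\<^bsub>P\<^esub> q) w = (\<Oplus>s \<in> {(u, v). u @ v = w}. \<zero>)"
      unfolding mult_P by (intro finsum_cong') auto
    then show False using w(1) by simp
  qed
qed

text \<open>Linearity in each factor is proved coefficientwise, before any ring structure is
  available. Together with \<open>monom_mult\<close> it then yields associativity, the unit laws,
  distributivity and compatibility with scalars.\<close>

lemma mult_left_linear:
  assumes p: "p \<in> carrier P"
  shows "(\<lambda>q. p \<otimes>\<^bsub>P\<^esub> q) \<in> linear_maps K P P"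
proof (rule linear_mapsI)
  fix q assume q: "q \<in> carrier P"
  show "p \<otimes>\<^bsub>P\<^esub> q \<in> carrier P" using p q by (rule mult_closed_P)
  show "p \<otimes>\<^bsub>P\<^esub> (q \<oplus>\<^bsub>P\<^esub> r) = p \<otimes>\<^bsub>P\<^esub> q \<oplus>\<^bsub>P\<^esub> p \<otimes>\<^bsub>P\<^esub> r" if r: "r \<in> carrier P" for r
    using p q r
    by (auto simp: mult_P add_P r_distr fun_eq_iff intro!: finsum_addf)
  show "p \<otimes>\<^bsub>P\<^esub> (a \<odot>\<^bsub>P\<^esub> q) = a \<odot>\<^bsub>P\<^esub> (p \<otimes>\<^bsub>P\<^esub> q)" if a: "a \<in> carrier K" for a
    using p q a finite_splits
    by (auto simp: mult_P smult_P m_lcomm finsum_rdistr fun_eq_iff intro!: finsum_cong')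
qed

lemma mult_right_linear:
  assumes p: "p \<in> carrier P"
  shows "(\<lambda>q. q \<otimes>\<^bsub>P\<^esub> p) \<in> linear_maps K P P"
proof (rule linear_mapsI)
  fix q assume q: "q \<in> carrier P"
  show "q \<otimes>\<^bsub>P\<^esub> p \<in> carrier P" using q p by (rule mult_closed_P)
  show "(q \<oplus>\<^bsub>P\<^esub> r) \<otimes>\<^bsub>P\<^esub> p = q \<otimes>\<^bsub>P\<^esub> p \<oplus>\<^bsub>P\<^esub> r \<otimes>\<^bsub>P\<^esub> p" if r: "r \<in> carrier P" for r
    using p q r
    by (auto simp: mult_P add_P l_distr fun_eq_iff intro!: finsum_addf)
  show "(a \<odot>\<^bsub>P\<^esub> q) \<otimes>\<^bsub>P\<^esub> p = a \<odot>\<^bsub>P\<^esub> (q \<otimes>\<^bsub>P\<^esub> p)" if a: "a \<in> carrier K" for a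
    using p q a finite_splits
    by (auto simp: mult_P smult_P m_assoc finsum_rdistr fun_eq_iff intro!: finsum_cong')
qed

text \<open>Among all splits of \<open>w\<close> only the pair \<open>(u, v)\<close> can contribute,
  and it occurs exactly when \<open>u @ v = w\<close>. Since \<open>u\<close> and \<open>v\<close>
  are arbitrary lists, the rule rewrites without membership conditions.\<close>

lemma monom_mult: "nc_monom K u \<otimes>\<^bsub>P\<^esub> nc_monom K v = nc_monom K (u @ v)"
proof
  fix w
  have "(nc_monom K u \<otimes>\<^bsub>P\<^esub> nc_monom K v) w =
      (\<Oplus>s \<in> {(u', v'). u' @ v' = w}. if (u, v) = s then \<one> else \<zero>)"
    unfolding mult_P by (intro finsum_cong') (auto simp: nc_monom_def)
  also have "\<dots> = nc_monom K (u @ v) w"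
  proof (cases "u @ v = w")
    case True
    then show ?thesis
      using add.finprod_singleton[of "(u, v)" "{(u', v'). u' @ v' = w}" "\<lambda>_. \<one>"] finite_splits
      by (simp add: nc_monom_def)
  next
    case False
    then have "(\<Oplus>s \<in> {(u', v'). u' @ v' = w}. if (u, v) = s then \<one> else \<zero>) =
        (\<Oplus>s \<in> {(u', v'). u' @ v' = w}. \<zero>)"
      by (intro finsum_cong') auto
    with False show ?thesis by (auto simp: nc_monom_def)
  qed
  finally show "(nc_monom K u \<otimes>\<^bsub>P\<^esub> nc_monom K v) w = nc_monom K (u @ v) w" .
qed

text \<open>Trilinearity reduces the claim to words, first in \<open>r\<close>, then in
  \<open>q\<close>, then in \<open>p\<close>. On three words it is associativity of
  \<open>@\<close>.\<close>

lemma mult_assoc_P: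
  assumes p: "p \<in> carrier P" and q: "q \<in> carrier P" and r: "r \<in> carrier P"
  shows "(p \<otimes>\<^bsub>P\<^esub> q) \<otimes>\<^bsub>P\<^esub> r = p \<otimes>\<^bsub>P\<^esub> (q \<otimes>\<^bsub>P\<^esub> r)"
proof -
  note L = mult_left_linear and R = mult_right_linear
  have 1: "(nc_monom K u \<otimes>\<^bsub>P\<^esub> nc_monom K v) \<otimes>\<^bsub>P\<^esub> r = nc_monom K u \<otimes>\<^bsub>P\<^esub> (nc_monom K v \<otimes>\<^bsub>P\<^esub> r)"
    if "u \<in> lists V" "v \<in> lists V" for u v
  proof -
    note u = monom_closed[OF that(1)] and v = monom_closed[OF that(2)]
    show ?thesis
      by (rule linear_maps_eqI[OF module_P L[OF mult_closed_P[OF u v]]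
            linear_maps_comp[OF L[OF u] L[OF v]] _ r])
        (simp add: monom_mult)
  qed
  have 2: "(nc_monom K u \<otimes>\<^bsub>P\<^esub> q) \<otimes>\<^bsub>P\<^esub> r = nc_monom K u \<otimes>\<^bsub>P\<^esub> (q \<otimes>\<^bsub>P\<^esub> r)"
    if "u \<in> lists V" for u
  proof -
    note u = monom_closed[OF that]
    show ?thesis
      by (rule linear_maps_eqI[OF module_P linear_maps_comp[OF R[OF r] L[OF u]]
            linear_maps_comp[OF L[OF u] R[OF r]] 1[OF that] q])
  qed
  show ?thesis
    by (rule linear_maps_eqI[OF module_P linear_maps_comp[OF R[OF r] R[OF q]]
          R[OF mult_closed_P[OF q r]] 2 p])
qed

lemma nc_algebra_P: "nc_algebra K P"
proof (intro nc_algebra.intro nc_algebra_axioms.intro)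
  show "module K P" by (rule module_P)
  show "ring P"
  proof (intro ringI)
    show "abelian_group P" by (rule P.abelian_group_axioms)
    show "Group.monoid P"
    proof (rule monoidI)
      show "\<one>\<^bsub>P\<^esub> \<in> carrier P" by (simp add: one_P)
      fix p assume p: "p \<in> carrier P"
      show "\<one>\<^bsub>P\<^esub> \<otimes>\<^bsub>P\<^esub> p = p"
        by (rule linear_maps_eqI[OF module_P _ _ _ p])
          (auto simp: one_P monom_mult intro: mult_left_linear linear_maps_id)
      show "p \<otimes>\<^bsub>P\<^esub> \<one>\<^bsub>P\<^esub> = p"
        by (rule linear_maps_eqI[OF module_P _ _ _ p])
          (auto simp: one_P monom_mult intro: mult_right_linear linear_maps_id)
    qed (auto simp: mult_closed_P mult_assoc_P)
  qed (simp_all add: linear_maps_add[OF mult_left_linear] linear_maps_add[OF mult_right_linear])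
qed (simp_all add: linear_maps_smult[OF mult_left_linear] linear_maps_smult[OF mult_right_linear])

sublocale P: nc_algebra K P by (rule nc_algebra_P)

end

section \<open>The free multi-differential algebra\<close>

locale nc_poly_diff = cring K for K :: "('k, 'e) ring_scheme" (structure) +
  fixes \<Omega> :: "'w set" and X :: "'x set"

sublocale nc_poly_diff \<subseteq> nc_poly K "diff_vars \<Omega> X" ..

context nc_poly_diff
begin

abbreviation D :: "'w \<Rightarrow> (('w, 'x) dvar list \<Rightarrow> 'k) \<Rightarrow> (('w, 'x) dvar list \<Rightarrow> 'k)" where
  "D \<equiv> free_deriv K \<Omega> X"

section \<open>The operators \<open>D \<omega>\<close> are derivations\<close>

lemma diff_vars_Cons: "\<lbrakk>\<omega> \<in> \<Omega>; v \<in> diff_vars \<Omega> X\<rbrakk> \<Longrightarrow> (\<omega> # fst v, snd v) \<in> diff_vars \<Omega> X"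
  by (auto simp: diff_vars_def)

text \<open>This is the form of the recursion used from here on: it speaks of \<open>P\<close>, and
  its leading product of monomials is already concatenated. The original equations mention
  \<open>free_mda\<close>, so later simplifier calls keep them out.\<close>

lemma word_deriv_Cons:
  "word_deriv K \<Omega> X \<omega> (v # w) =
     nc_monom K ((\<omega> # fst v, snd v) # w) \<oplus>\<^bsub>P\<^esub> nc_monom K [v] \<otimes>\<^bsub>P\<^esub> word_deriv K \<Omega> X \<omega> w"
  by (simp add: free_mda_def monom_mult)

lemma word_deriv_Nil: "word_deriv K \<Omega> X \<omega> [] = \<zero>\<^bsub>P\<^esub>"
  by (simp add: free_mda_def)

lemma word_deriv_closed:
  assumes "\<omega> \<in> \<Omega>" and "w \<in> lists (diff_vars \<Omega> X)"
  shows "word_deriv K \<Omega> X \<omega> w \<in> carrier P"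
  using assms(2)
proof (induction w)
  case Nil
  show ?case by (simp only: word_deriv_Nil P.zero_closed)
next
  case (Cons v w)
  then have "nc_monom K ((\<omega> # fst v, snd v) # w) \<in> carrier P" "nc_monom K [v] \<in> carrier P"
    using diff_vars_Cons[OF assms(1)] by (auto intro!: monom_closed)
  then show ?case
    unfolding word_deriv_Cons using Cons.IH by (intro P.add.m_closed P.m_closed)
qed

lemma D_eq_lin_ext: "D \<omega> = lin_ext P (word_deriv K \<Omega> X \<omega>)"
  by (simp add: fun_eq_iff free_deriv_def lin_ext_def free_mda_def)

lemma D_linear: "\<omega> \<in> \<Omega> \<Longrightarrow> D \<omega> \<in> linear_maps K P P"
  unfolding D_eq_lin_ext by (rule lin_ext_linear[OF module_P]) (rule word_deriv_closed)

lemma D_monom: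
  "\<lbrakk>\<omega> \<in> \<Omega>; w \<in> lists (diff_vars \<Omega> X)\<rbrakk> \<Longrightarrow> D \<omega> (nc_monom K w) = word_deriv K \<Omega> X \<omega> w"
  unfolding D_eq_lin_ext by (rule lin_ext_monom[OF module_P]) (rule word_deriv_closed)

text \<open>In the Leibniz recursion for a one-letter word the second summand is a multiple of the
  derivative of the empty word, hence zero. This recovers the prescribed action on
  variables.\<close>

lemma D_var:
  assumes "\<omega> \<in> \<Omega>" and "v \<in> diff_vars \<Omega> X"
  shows "D \<omega> (nc_monom K [v]) = nc_monom K [(\<omega> # fst v, snd v)]"
proof -
  have "nc_monom K [v] \<in> carrier P" "nc_monom K [(\<omega> # fst v, snd v)] \<in> carrier P"
    using diff_vars_Cons[OF assms] assms by (auto intro!: monom_closed)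
  moreover have "D \<omega> (nc_monom K [v]) = word_deriv K \<Omega> X \<omega> [v]"
    using assms by (intro D_monom) auto
  ultimately show ?thesis
    by (simp only: word_deriv_Cons word_deriv_Nil P.r_null P.r_zero)
qed

text \<open>The defining recursion is the Leibniz rule for a one-letter first factor. Induction on
  \<open>u\<close> extends it to any first factor, with distributivity and associativity regrouping
  the three resulting terms.\<close>

lemma word_deriv_append:
  assumes \<omega>: "\<omega> \<in> \<Omega>" and u: "u \<in> lists (diff_vars \<Omega> X)" and v: "v \<in> lists (diff_vars \<Omega> X)"
  shows "word_deriv K \<Omega> X \<omega> (u @ v) =
    word_deriv K \<Omega> X \<omega> u \<otimes>\<^bsub>P\<^esub> nc_monom K v \<oplus>\<^bsub>P\<^esub> nc_monom K u \<otimes>\<^bsub>P\<^esub> word_deriv K \<Omega> X \<omega> v"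
  using u
proof (induction u)
  case Nil
  have "nc_monom K v \<in> carrier P" "word_deriv K \<Omega> X \<omega> v \<in> carrier P"
    using v word_deriv_closed[OF \<omega>] by auto
  then show ?case
    by (simp only: word_deriv_Nil append_Nil one_P[symmetric] P.l_null P.l_one P.l_zero)
next
  case (Cons x u)
  let ?d = "word_deriv K \<Omega> X \<omega>"
  have cl: "nc_monom K ((\<omega> # fst x, snd x) # u) \<in> carrier P" "nc_monom K [x] \<in> carrier P"
      "nc_monom K u \<in> carrier P" "nc_monom K v \<in> carrier P" "?d u \<in> carrier P" "?d v \<in> carrier P"
    using Cons v diff_vars_Cons[OF \<omega>, of x] by (auto intro!: monom_closed word_deriv_closed[OF \<omega>])
  have 1: "nc_monom K ((\<omega> # fst x, snd x) # u @ v) =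
      nc_monom K ((\<omega> # fst x, snd x) # u) \<otimes>\<^bsub>P\<^esub> nc_monom K v"
    and 2: "nc_monom K (x # u) = nc_monom K [x] \<otimes>\<^bsub>P\<^esub> nc_monom K u"
    by (simp_all add: monom_mult)
  show ?case
    unfolding append_Cons word_deriv_Cons Cons.IH 1 2
    using cl by (simp del: word_deriv.simps add: P.l_distr P.r_distr P.m_assoc P.a_assoc)
qed

lemma D_mult:
  assumes \<omega>: "\<omega> \<in> \<Omega>" and p: "p \<in> carrier P" and q: "q \<in> carrier P"
  shows "D \<omega> (p \<otimes>\<^bsub>P\<^esub> q) = D \<omega> p \<otimes>\<^bsub>P\<^esub> q \<oplus>\<^bsub>P\<^esub> p \<otimes>\<^bsub>P\<^esub> D \<omega> q"
proof -
  note D = D_linear[OF \<omega>]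
  note Dcl = linear_maps_closed[OF D]
  \<comment> \<open>Both sides of the Leibniz rule are linear in the second factor
    (\<open>lin1\<close>, \<open>lin3\<close>) and in the first (\<open>lin2\<close>,
    \<open>lin4\<close>). The fixed factor stays general because it is a monomial in one use and
    \<open>q\<close> in the other.\<close>
  have lin1: "(\<lambda>q. D \<omega> (p \<otimes>\<^bsub>P\<^esub> q)) \<in> linear_maps K P P"
    and lin2: "(\<lambda>q. D \<omega> (q \<otimes>\<^bsub>P\<^esub> p)) \<in> linear_maps K P P"
    and lin3: "(\<lambda>q. D \<omega> p \<otimes>\<^bsub>P\<^esub> q \<oplus>\<^bsub>P\<^esub> p \<otimes>\<^bsub>P\<^esub> D \<omega> q) \<in> linear_maps K P P"
    and lin4: "(\<lambda>q. D \<omega> q \<otimes>\<^bsub>P\<^esub> p \<oplus>\<^bsub>P\<^esub> q \<otimes>\<^bsub>P\<^esub> D \<omega> p) \<in> linear_maps K P P"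
    if p: "p \<in> carrier P" for p
    by (rule linear_maps_comp[OF D P.linear_maps_mult_left[OF p]]
        linear_maps_comp[OF D P.linear_maps_mult_right[OF p]]
        linear_maps_plus[OF module_P P.linear_maps_mult_left[OF Dcl[OF p]]
          linear_maps_comp[OF P.linear_maps_mult_left[OF p] D]]
        linear_maps_plus[OF module_P linear_maps_comp[OF P.linear_maps_mult_right[OF p] D]
          P.linear_maps_mult_right[OF Dcl[OF p]]])+
  have 1: "D \<omega> (nc_monom K u \<otimes>\<^bsub>P\<^esub> q) =
      D \<omega> (nc_monom K u) \<otimes>\<^bsub>P\<^esub> q \<oplus>\<^bsub>P\<^esub> nc_monom K u \<otimes>\<^bsub>P\<^esub> D \<omega> q"
    if u: "u \<in> lists (diff_vars \<Omega> X)" for u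
  proof (rule linear_maps_eqI[OF module_P lin1[OF monom_closed[OF u]]
        lin3[OF monom_closed[OF u]] _ q])
    fix v assume v: "v \<in> lists (diff_vars \<Omega> X)"
    then have "u @ v \<in> lists (diff_vars \<Omega> X)" using u by simp
    then show "D \<omega> (nc_monom K u \<otimes>\<^bsub>P\<^esub> nc_monom K v) =
      D \<omega> (nc_monom K u) \<otimes>\<^bsub>P\<^esub> nc_monom K v \<oplus>\<^bsub>P\<^esub> nc_monom K u \<otimes>\<^bsub>P\<^esub> D \<omega> (nc_monom K v)"
      unfolding monom_mult by (simp only: D_monom[OF \<omega>] u v word_deriv_append[OF \<omega>])
  qed
  show ?thesis
    by (rule linear_maps_eqI[OF module_P lin2[OF q] lin4[OF q] 1 p])
qed

lemma multi_diff_algebra_free: "multi_diff_algebra K \<Omega> (free_mda K \<Omega> X) D"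
  unfolding multi_diff_algebra_def derivation_def free_mda_def
  using nc_algebra_P D_linear D_mult by (auto simp: linear_maps_def)

end

section \<open>The universal property\<close>

locale nc_poly_diff_target = nc_poly_diff K \<Omega> X
  for K :: "('k, 'e) ring_scheme" (structure) and \<Omega> :: "'w set" and X :: "'x set" +
  fixes A :: "('k, 'a, 'm) module_scheme" and \<delta> :: "'w \<Rightarrow> 'a \<Rightarrow> 'a" and f :: "'x \<Rightarrow> 'a"
  assumes target: "multi_diff_algebra K \<Omega> A \<delta>" and f_closed: "f \<in> X \<rightarrow> carrier A"
begin

sublocale A: nc_algebra K A
  using target by (simp add: multi_diff_algebra_def)

section \<open>Values of differential variables and words in the target\<close>

lemma \<delta>_linear: "\<omega> \<in> \<Omega> \<Longrightarrow> \<delta> \<omega> \<in> linear_maps K A A"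
  using target by (auto simp: multi_diff_algebra_def derivation_def linear_maps_def)

lemma \<delta>_mult:
  "\<lbrakk>\<omega> \<in> \<Omega>; x \<in> carrier A; y \<in> carrier A\<rbrakk> \<Longrightarrow>
     \<delta> \<omega> (x \<otimes>\<^bsub>A\<^esub> y) = \<delta> \<omega> x \<otimes>\<^bsub>A\<^esub> y \<oplus>\<^bsub>A\<^esub> x \<otimes>\<^bsub>A\<^esub> \<delta> \<omega> y"
  using target by (auto simp: multi_diff_algebra_def derivation_def)

text \<open>The Leibniz rule at a product of two units gives \<open>d = d \<oplus> d\<close> for the
  derivative \<open>d\<close> of the unit, and one copy cancels. This handles the empty word in
  \<open>hom_ext_word_deriv\<close>.\<close>

lemma \<delta>_one:
  assumes "\<omega> \<in> \<Omega>"
  shows "\<delta> \<omega> \<one>\<^bsub>A\<^esub> = \<zero>\<^bsub>A\<^esub>"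
proof -
  have cl: "\<delta> \<omega> \<one>\<^bsub>A\<^esub> \<in> carrier A" using linear_maps_closed[OF \<delta>_linear[OF assms]] by simp
  have "\<delta> \<omega> \<one>\<^bsub>A\<^esub> = \<delta> \<omega> \<one>\<^bsub>A\<^esub> \<oplus>\<^bsub>A\<^esub> \<delta> \<omega> \<one>\<^bsub>A\<^esub>"
    using \<delta>_mult[OF assms A.one_closed A.one_closed] cl by simp
  then show ?thesis using cl by (metis A.add.l_cancel_one')
qed

text \<open>With \<open>foldr\<close> the head of the list is the outermost operator, matching
  \<open>D \<omega>\<close>, which prepends its symbol.\<close>

definition var_val :: "('w, 'x) dvar \<Rightarrow> 'a" where
  "var_val v = foldr \<delta> (fst v) (f (snd v))"

definition word_val :: "('w, 'x) dvar list \<Rightarrow> 'a" where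
  "word_val w = foldr (\<lambda>v a. var_val v \<otimes>\<^bsub>A\<^esub> a) w \<one>\<^bsub>A\<^esub>"

lemma word_val_simps [simp]:
  "word_val [] = \<one>\<^bsub>A\<^esub>" "word_val (v # w) = var_val v \<otimes>\<^bsub>A\<^esub> word_val w"
  by (simp_all add: word_val_def)

lemma var_val_closed:
  assumes "v \<in> diff_vars \<Omega> X"
  shows "var_val v \<in> carrier A"
proof -
  have "foldr \<delta> ds (f x) \<in> carrier A" if "ds \<in> lists \<Omega>" "x \<in> X" for ds x
    using that f_closed by (induction ds) (auto intro: linear_maps_closed[OF \<delta>_linear])
  then show ?thesis
    using assms unfolding var_val_def diff_vars_def by (metis mem_Times_iff)
qed

lemma word_val_closed: "w \<in> lists (diff_vars \<Omega> X) \<Longrightarrow> word_val w \<in> carrier A"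
  by (induction w) (auto simp: var_val_closed)

lemma word_val_append:
  assumes "u \<in> lists (diff_vars \<Omega> X)" and "v \<in> lists (diff_vars \<Omega> X)"
  shows "word_val (u @ v) = word_val u \<otimes>\<^bsub>A\<^esub> word_val v"
  using assms by (induction u) (simp_all add: var_val_closed word_val_closed A.m_assoc)

section \<open>Existence of the induced homomorphism\<close>

definition hom_ext :: "(('w, 'x) dvar list \<Rightarrow> 'k) \<Rightarrow> 'a" where
  "hom_ext = lin_ext A word_val"

lemma hom_ext_linear: "hom_ext \<in> linear_maps K P A"
  unfolding hom_ext_def by (rule lin_ext_linear[OF A.module_axioms]) (rule word_val_closed)

lemma hom_ext_monom: "w \<in> lists (diff_vars \<Omega> X) \<Longrightarrow> hom_ext (nc_monom K w) = word_val w"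
  unfolding hom_ext_def by (rule lin_ext_monom[OF A.module_axioms]) (rule word_val_closed)

text \<open>Both sides are bilinear, and on words the claim is
  \<open>word_val_append\<close>.\<close>

lemma hom_ext_mult:
  assumes p: "p \<in> carrier P" and q: "q \<in> carrier P"
  shows "hom_ext (p \<otimes>\<^bsub>P\<^esub> q) = hom_ext p \<otimes>\<^bsub>A\<^esub> hom_ext q"
proof -
  note lin = hom_ext_linear
  \<comment> \<open>The first two facts describe the two sides as functions of the second factor,
    the last two as functions of the first. The fixed factor is left open.\<close>
  note lins =
    linear_maps_comp[OF lin P.linear_maps_mult_left]
    linear_maps_comp[OF A.linear_maps_mult_left[OF linear_maps_closed[OF lin]] lin]
    linear_maps_comp[OF lin P.linear_maps_mult_right]
    linear_maps_comp[OF A.linear_maps_mult_right[OF linear_maps_closed[OF lin]] lin]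
  have 1: "hom_ext (nc_monom K u \<otimes>\<^bsub>P\<^esub> q) = hom_ext (nc_monom K u) \<otimes>\<^bsub>A\<^esub> hom_ext q"
    if u: "u \<in> lists (diff_vars \<Omega> X)" for u
  proof (rule linear_maps_eqI[OF A.module_axioms lins(1,2)[OF monom_closed[OF u]] _ q])
    fix v assume v: "v \<in> lists (diff_vars \<Omega> X)"
    then have "u @ v \<in> lists (diff_vars \<Omega> X)" using u by simp
    then show "hom_ext (nc_monom K u \<otimes>\<^bsub>P\<^esub> nc_monom K v) =
      hom_ext (nc_monom K u) \<otimes>\<^bsub>A\<^esub> hom_ext (nc_monom K v)"
      unfolding monom_mult by (simp only: hom_ext_monom u v word_val_append)
  qed
  show ?thesis
    by (rule linear_maps_eqI[OF A.module_axioms lins(3,4)[OF q] 1 p])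
qed

text \<open>Both sides obey the same recursion on \<open>w\<close>: \<open>word_deriv\<close> by its
  definition, and \<delta> \<omega> by its Leibniz rule on a product of values. They match because
  prepending \<omega> to a variable applies \<delta> \<omega> to its value.\<close>

lemma hom_ext_word_deriv:
  assumes \<omega>: "\<omega> \<in> \<Omega>" and w: "w \<in> lists (diff_vars \<Omega> X)"
  shows "hom_ext (word_deriv K \<Omega> X \<omega> w) = \<delta> \<omega> (word_val w)"
  using w
proof (induction w)
  case Nil
  show ?case
    unfolding word_deriv_Nil using linear_maps_zero[OF module_P A.module_axioms hom_ext_linear]
    by (simp add: \<delta>_one[OF \<omega>])
next
  case (Cons v w)
  let ?dv = "(\<omega> # fst v, snd v)"
  have dv: "?dv \<in> diff_vars \<Omega> X" using diff_vars_Cons[OF \<omega>] Cons.hyps by auto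
  have mem: "?dv # w \<in> lists (diff_vars \<Omega> X)" "[v] \<in> lists (diff_vars \<Omega> X)"
    using dv Cons.hyps by auto
  have val: "var_val ?dv = \<delta> \<omega> (var_val v)" by (simp add: var_val_def)
  have cl: "word_deriv K \<Omega> X \<omega> w \<in> carrier P" "nc_monom K (?dv # w) \<in> carrier P"
      "nc_monom K [v] \<in> carrier P"
    using mem Cons.hyps by (auto intro!: word_deriv_closed[OF \<omega>] monom_closed)
  have "hom_ext (word_deriv K \<Omega> X \<omega> (v # w)) =
      hom_ext (nc_monom K (?dv # w)) \<oplus>\<^bsub>A\<^esub>
      hom_ext (nc_monom K [v]) \<otimes>\<^bsub>A\<^esub> hom_ext (word_deriv K \<Omega> X \<omega> w)"
    unfolding word_deriv_Cons
    by (simp only: linear_maps_add[OF hom_ext_linear] hom_ext_mult cl P.m_closed)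
  also have "\<dots> = \<delta> \<omega> (var_val v) \<otimes>\<^bsub>A\<^esub> word_val w \<oplus>\<^bsub>A\<^esub> var_val v \<otimes>\<^bsub>A\<^esub> \<delta> \<omega> (word_val w)"
    using Cons.hyps by (simp only: hom_ext_monom mem Cons.IH word_val_simps val)
      (simp add: var_val_closed)
  also have "\<dots> = \<delta> \<omega> (word_val (v # w))"
    using Cons.hyps by (simp add: \<delta>_mult[OF \<omega>] var_val_closed word_val_closed)
  finally show ?case .
qed

lemma hom_ext_D:
  assumes \<omega>: "\<omega> \<in> \<Omega>" and p: "p \<in> carrier P"
  shows "hom_ext (D \<omega> p) = \<delta> \<omega> (hom_ext p)"
  by (rule linear_maps_eqI[OF A.module_axioms linear_maps_comp[OF hom_ext_linear D_linear[OF \<omega>]]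
        linear_maps_comp[OF \<delta>_linear[OF \<omega>] hom_ext_linear] _ p])
    (simp only: D_monom[OF \<omega>] hom_ext_word_deriv[OF \<omega>] hom_ext_monom)

lemma hom_ext_hom:
  "restrict hom_ext (carrier P) \<in> multi_diff_hom K \<Omega> (free_mda K \<Omega> X) D A \<delta>"
proof -
  have "hom_ext \<one>\<^bsub>P\<^esub> = \<one>\<^bsub>A\<^esub>" by (simp add: one_P hom_ext_monom)
  then have "restrict hom_ext (carrier P) \<in> ring_hom P A"
    using linear_maps_closed[OF hom_ext_linear] linear_maps_add[OF hom_ext_linear]
    by (intro ring_hom_memI) (auto simp: hom_ext_mult)
  \<comment> \<open>The homomorphism is the restriction of \<open>hom_ext\<close>, so evaluating it
    at \<open>D \<omega> p\<close> requires that this element lie in the carrier.\<close>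
  moreover have "D \<omega> p \<in> carrier P" if "\<omega> \<in> \<Omega>" "p \<in> carrier P" for \<omega> p
    using linear_maps_closed[OF D_linear] that by blast
  ultimately show ?thesis
    unfolding multi_diff_hom_def free_mda_def
    using linear_maps_smult[OF hom_ext_linear] hom_ext_D by auto
qed

lemma hom_ext_inj:
  assumes "x \<in> X"
  shows "restrict hom_ext (carrier P) (free_inj K x) = f x"
proof -
  have mem: "[([], x)] \<in> lists (diff_vars \<Omega> X)" using assms by (simp add: diff_vars_def)
  \<comment> \<open>The value of a one-letter word has a trailing unit factor, which is cancelled
    once \<open>f x\<close> is known to lie in the carrier.\<close>
  have "f x \<in> carrier A" using assms f_closed by auto
  then show ?thesis
    using monom_closed[OF mem] hom_ext_monom[OF mem] by (simp add: free_inj_def var_val_def)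
qed

text \<open>The values of \<open>g\<close> are forced in stages: on variables by compatibility with
  derivations, on words by multiplicativity, on polynomials by linearity, and off the carrier by
  extensionality.\<close>

lemma hom_unique:
  assumes g: "g \<in> multi_diff_hom K \<Omega> (free_mda K \<Omega> X) D A \<delta>"
    and gf: "\<And>x. x \<in> X \<Longrightarrow> g (free_inj K x) = f x"
  shows "g = restrict hom_ext (carrier P)"
proof
  have hom: "g \<in> ring_hom P A" and ext: "g \<in> extensional (carrier P)"
    and smult: "\<And>a p. \<lbrakk>a \<in> carrier K; p \<in> carrier P\<rbrakk> \<Longrightarrow> g (a \<odot>\<^bsub>P\<^esub> p) = a \<odot>\<^bsub>A\<^esub> g p"
    and gD: "\<And>\<omega> p. \<lbrakk>\<omega> \<in> \<Omega>; p \<in> carrier P\<rbrakk> \<Longrightarrow> g (D \<omega> p) = \<delta> \<omega> (g p)"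
    using g by (auto simp: multi_diff_hom_def free_mda_def)
  have lin: "g \<in> linear_maps K P A"
    using hom smult by (intro linear_mapsI) (auto simp: ring_hom_def)
  have var: "g (nc_monom K [(ds, x)]) = var_val (ds, x)" if "ds \<in> lists \<Omega>" "x \<in> X" for ds x
    using that
  proof (induction ds)
    case Nil
    then show ?case using gf[of x] by (simp add: free_inj_def var_val_def)
  next
    case (Cons \<omega> ds)
    then have \<omega>: "\<omega> \<in> \<Omega>" and v: "(ds, x) \<in> diff_vars \<Omega> X" by (auto simp: diff_vars_def)
    \<comment> \<open>By \<open>D_var\<close> the longer variable is the image under
      \<open>D \<omega>\<close> of the shorter one, whose value is already known.\<close>
    have "g (nc_monom K [(\<omega> # ds, x)]) = g (D \<omega> (nc_monom K [(ds, x)]))"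
      using D_var[OF \<omega> v] by simp
    also have "\<dots> = \<delta> \<omega> (g (nc_monom K [(ds, x)]))"
      using v by (intro gD \<omega> monom_closed) auto
    finally show ?case using Cons by (simp add: var_val_def)
  qed
  have word: "g (nc_monom K w) = word_val w" if "w \<in> lists (diff_vars \<Omega> X)" for w
    using that
  proof (induction w)
    case Nil
    then show ?case using ring_hom_one[OF hom] by (simp add: one_P)
  next
    case (Cons v w)
    have "g (nc_monom K (v # w)) = g (nc_monom K [v] \<otimes>\<^bsub>P\<^esub> nc_monom K w)"
      by (simp add: monom_mult)
    also have "\<dots> = g (nc_monom K [v]) \<otimes>\<^bsub>A\<^esub> g (nc_monom K w)"
      using Cons.hyps by (intro ring_hom_mult[OF hom] monom_closed) auto
    also have "g (nc_monom K [v]) = var_val v"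
      using Cons.hyps var[of "fst v" "snd v"] by (simp add: diff_vars_def mem_Times_iff)
    finally show ?case using Cons.IH by simp
  qed
  show "g p = restrict hom_ext (carrier P) p" for p
  proof (cases "p \<in> carrier P")
    case True
    have "g p = hom_ext p"
      by (rule linear_maps_eqI[OF A.module_axioms lin hom_ext_linear _ True])
        (simp only: word hom_ext_monom)
    with True show ?thesis by simp
  next
    case False
    with ext show ?thesis by (simp add: extensional_def)
  qed
qed

end

theorem theorem2p9:
  fixes K :: "('k, 'e) ring_scheme" and \<Omega> :: "'w set" and X :: "'x set"
  assumes "field K" and "\<Omega> \<noteq> {}" and "X \<noteq> {}"
  shows "multi_diff_algebra K \<Omega> (free_mda K \<Omega> X) (free_deriv K \<Omega> X) \<and>
    (free_inj K :: 'x \<Rightarrow> ('w, 'x) dvar list \<Rightarrow> 'k) \<in> X \<rightarrow> carrier (free_mda K \<Omega> X) \<and>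
    inj_on (free_inj K :: 'x \<Rightarrow> ('w, 'x) dvar list \<Rightarrow> 'k) X \<and>
    (\<forall>(A :: ('k, 'a, 'm) module_scheme) (\<delta> :: 'w \<Rightarrow> 'a \<Rightarrow> 'a) (f :: 'x \<Rightarrow> 'a).
       multi_diff_algebra K \<Omega> A \<delta> \<and> f \<in> X \<rightarrow> carrier A \<longrightarrow>
       (\<exists>!g. g \<in> multi_diff_hom K \<Omega> (free_mda K \<Omega> X) (free_deriv K \<Omega> X) A \<delta> \<and>
             (\<forall>x\<in>X. g (free_inj K x) = f x)))"
proof (intro conjI allI impI)
  interpret K: field K by (rule assms(1))
  interpret nc_poly_diff K \<Omega> X ..
  show "multi_diff_algebra K \<Omega> (free_mda K \<Omega> X) (free_deriv K \<Omega> X)"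
    by (rule multi_diff_algebra_free)
  show "free_inj K \<in> X \<rightarrow> carrier (free_mda K \<Omega> X)"
    unfolding free_mda_def free_inj_def
    by (intro Pi_I monom_closed) (simp add: diff_vars_def)
  \<comment> \<open>Evaluating two equal monomials at the word of one of them would give
    \<open>\<one> = \<zero>\<close> if the words differed, which is impossible in a field.\<close>
  show "inj_on (free_inj K :: 'x \<Rightarrow> ('w, 'x) dvar list \<Rightarrow> 'k) X"
    by (auto simp: inj_on_def free_inj_def nc_monom_def fun_eq_iff split: if_splits)
  fix A :: "('k, 'a, 'm) module_scheme" and \<delta> :: "'w \<Rightarrow> 'a \<Rightarrow> 'a" and f :: "'x \<Rightarrow> 'a"
  assume "multi_diff_algebra K \<Omega> A \<delta> \<and> f \<in> X \<rightarrow> carrier A"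
  then interpret nc_poly_diff_target K \<Omega> X A \<delta> f
    by unfold_locales auto
  show "\<exists>!g. g \<in> multi_diff_hom K \<Omega> (free_mda K \<Omega> X) (free_deriv K \<Omega> X) A \<delta> \<and>
      (\<forall>x\<in>X. g (free_inj K x) = f x)"
    using hom_ext_hom hom_ext_inj hom_unique
    by (intro ex1I[of _ "restrict hom_ext (carrier P)"]) blast+
qed

end
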